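(* Let $\bar Q_0,\dots,\bar Q_M$ be the states of the matrix-valued Markov chain $\{\boldsymbol{Q}_n\}$ described in the context, let $P(\bar Q_j|\bar Q_i)$ be its transition probabilities, and for $\tilde Q\in\mathbb{R}^{(\nu+1)\times(\nu+1)}$ let $$P_{\tilde Q}=\big\{e^{\mathrm{tr}(\tilde Q\bar Q_j)}P(\bar Q_j|\bar Q_i)\big\}_{0\le i,j\le M},$$ with Perron-Frobenius eigenvalue $\rho(P_{\tilde Q})$. Then for every $\tilde Q\in\mathbb{R}^{(\nu+1)\times(\nu+1)}$, $$\frac{\partial \ln\rho(P_{\tilde Q})}{\partial\tilde Q}(\tilde Q)=\frac{1}{\rho(P_{\tilde Q})}\sum_{i=0}^{M}\lambda_i(\tilde Q)\sum_{j=0}^{M}\psi_j(\tilde Q)\,\bar Q_j\,P(\bar Q_j|\bar Q_i)\,e^{\mathrm{tr}(\tilde Q\bar Q_j)},$$ where $\lambda(\tilde Q)=(\lambda_0(\tilde Q),\dots,\lambda_M(\tilde Q))^T$ and $\psi(\tilde Q)=(\psi_0(\tilde Q),\dots,\psi_M(\tilde Q))^T$ are, respectively, left and right eigenvectors of $P_{\tilde Q}$ associated with the eigenvalue $\rho(P_{\tilde Q})$, normalized so that $\lambda(\tilde Q)^T\psi(\tilde Q)=1$.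
   Context: Let $\nu\ge 1$ be an integer, $\mathcal{X}\subset\mathbb{R}$ and $\mathcal{S}\subset(0,\infty)$ finite sets. Let $\{S_n\}$ be i.i.d. with law $P_S$ on $\mathcal{S}$. Let $\{X_n^{(0)}\}$ be an irreducible time-homogeneous Markov chain on $\mathcal{X}$ with transition matrix $\pi$, and let $\{X_n^{(a)}\}$, $a=1,\dots,\nu$, be irreducible time-homogeneous Markov chains on $\mathcal{X}$ with the same law and transition matrix $\tilde\pi$; the sequences $\{S_n\},\{X_n^{(0)}\},\dots,\{X_n^{(\nu)}\}$ are mutually independent. Define the $(\nu+1)\times(\nu+1)$ random matrices $\boldsymbol{Q}_n$ by $Q_n^{(a,b)}=S_nX_n^{(a)}X_n^{(b)}$ for $a,b\in\{0,\dots,\nu\}$. They take values in the finite set $\mathcal{Q}=\{s\,xx^T: s\in\mathcal{S},\,x\in\mathcal{X}^{\nu+1}\}$, enumerated as $\bar Q_0,\dots,\bar Q_M$, $M=|\mathcal{Q}|-1$. Standing assumption: $\{\boldsymbol{Q}_n\}$ is a time-homogeneous irreducible Markov chain on $\mathcal{Q}$, with transition probabilities $P(\bar Q_j|\bar Q_i)=\mathbb{P}(\boldsymbol{Q}_{n+1}=\bar Q_j|\boldsymbol{Q}_n=\bar Q_i)$. For a nonnegative irreducible square matrix $C$, the Perron-Frobenius eigenvalue $\rho(C)$ is its spectral radius, a simple positive eigenvalue. For a function $f$ of a matrix $\tilde Q$, $\partial f/\partial\tilde Q$ denotes the matrix of partial derivatives $\partial f/\partial\tilde Q_{ab}$, all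 entries of $\tilde Q$ being treated as independent variables. $\ln$ is the natural logarithm. *)

theory Defs
  imports
    "HOL-Probability.Probability"
    "Jordan_Normal_Form.Spectral_Radius"
begin

text \<open>
  In what follows, \<open>$\<close> and \<open>real ^ 'n ^ 'n\<close> refer to the vectors and matrices of
  HOL-Analysis (used for the states of the matrix-valued chain), whereas
  \<open>real Matrix.mat\<close> and \<open>real Matrix.vec\<close> from Jordan_Normal_Form are used for
  the matrices and vectors that are indexed by the enumeration of the states.
\<close>

no_notation Matrix.vec_index (infixl \<open>$\<close> 100)

text \<open>The transition probability from \<open>x\<close> to \<open>y\<close> is \<open>p x y\<close>; the initial law is arbitrary.\<close>

definition markov_chain ::
    "'w measure \<Rightarrow> 's set \<Rightarrow> ('s \<Rightarrow> 's \<Rightarrow> real) \<Rightarrow> (nat \<Rightarrow> 'w \<Rightarrow> 's) \<Rightarrow> bool" where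
  "markov_chain \<Omega> A p Y \<longleftrightarrow>
     prob_space \<Omega> \<and>
     (\<forall>n. Y n \<in> measurable \<Omega> (count_space A)) \<and>
     (\<forall>x\<in>A. \<forall>y\<in>A. 0 \<le> p x y) \<and>
     (\<forall>x\<in>A. (\<Sum>y\<in>A. p x y) = 1) \<and>
     (\<forall>n. \<forall>q. (\<forall>k. q k \<in> A) \<longrightarrow> \<P>(\<omega> in \<Omega>. \<forall>k\<le>n. Y k \<omega> = q k) > 0 \<longrightarrow>
        \<P>(\<omega> in \<Omega>. Y (Suc n) \<omega> = q (Suc n) \<bar> \<forall>k\<le>n. Y k \<omega> = q k) = p (q n) (q (Suc n)))"

definition irreducible_on :: "'s set \<Rightarrow> ('s \<Rightarrow> 's \<Rightarrow> real) \<Rightarrow> bool" where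
  "irreducible_on A p \<longleftrightarrow>
     (\<forall>x\<in>A. \<forall>y\<in>A. (x, y) \<in> {(u, v). u \<in> A \<and> v \<in> A \<and> p u v > 0}\<^sup>+)"

definition irreducible_markov_chain ::
    "'w measure \<Rightarrow> 's set \<Rightarrow> ('s \<Rightarrow> 's \<Rightarrow> real) \<Rightarrow> (nat \<Rightarrow> 'w \<Rightarrow> 's) \<Rightarrow> bool" where
  "irreducible_markov_chain \<Omega> A p Y \<longleftrightarrow> markov_chain \<Omega> A p Y \<and> irreducible_on A p"

text \<open>
  The index set \<open>{0, \<dots>, \<nu>}\<close> is represented by the type \<open>'r option\<close>, where \<open>'r\<close> is a
  finite type with \<open>\<nu>\<close> elements: \<open>None\<close> is the index \<open>0\<close> and \<open>Some a\<close> ranges over the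
  indices \<open>1, \<dots>, \<nu>\<close>. The definitions below work for any finite index type.
\<close>

text \<open>The set of matrices \<open>s x x\<^sup>T\<close> with \<open>s \<in> \<S>\<close> and \<open>x \<in> \<X>\<^sup>\<nu>\<^sup>+\<^sup>1\<close>.\<close>

definition rank_one_states :: "real set \<Rightarrow> real set \<Rightarrow> (real ^ 'n ^ 'n) set" where
  "rank_one_states \<S> \<X> =
     {(\<chi> a b. s * x $ a * x $ b) | s (x :: real ^ 'n). s \<in> \<S> \<and> (\<forall>a. x $ a \<in> \<X>)}"

definition Q_process ::
    "(nat \<Rightarrow> 'w \<Rightarrow> real) \<Rightarrow> ('n \<Rightarrow> nat \<Rightarrow> 'w \<Rightarrow> real) \<Rightarrow> nat \<Rightarrow> 'w \<Rightarrow> real ^ 'n ^ 'n" where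
  "Q_process S X n \<omega> = (\<chi> a b. S n \<omega> * X a n \<omega> * X b n \<omega>)"

text \<open>
  The rows are indexed by the current state and the columns by the next state;
  \<open>P q q'\<close> stands for \<open>P(q'|q)\<close>.
\<close>

definition tilted_matrix ::
    "nat \<Rightarrow> (nat \<Rightarrow> real ^ 'n ^ 'n) \<Rightarrow> (real ^ 'n ^ 'n \<Rightarrow> real ^ 'n ^ 'n \<Rightarrow> real)
      \<Rightarrow> real ^ 'n ^ 'n \<Rightarrow> real Matrix.mat" where
  "tilted_matrix N Qbar P Qt =
     Matrix.mat N N (\<lambda>(i, j). exp (trace (Qt ** Qbar j)) * P (Qbar i) (Qbar j))"

definition pf_eigenvalue :: "real Matrix.mat \<Rightarrow> real" where
  "pf_eigenvalue C = spectral_radius (map_mat complex_of_real C)"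

text \<open>
  Entry \<open>(a, b)\<close> of \<open>D\<close> is the partial derivative of \<open>f\<close> at \<open>A\<close> with respect to entry
  \<open>(a, b)\<close>, all other entries being kept fixed (no symmetry constraint).
\<close>

definition has_matrix_of_partials ::
    "(real ^ 'n ^ 'm \<Rightarrow> real) \<Rightarrow> real ^ 'n ^ 'm \<Rightarrow> real ^ 'n ^ 'm \<Rightarrow> bool" where
  "has_matrix_of_partials f D A \<longleftrightarrow>
     (\<forall>a b. ((\<lambda>t. f (\<chi> i j. if i = a \<and> j = b then t else A $ i $ j))
               has_real_derivative D $ a $ b) (at (A $ a $ b)))"

end

theory Submission
  imports Defs
begin

text \<open>
  Left and right Perron eigenvectors \<open>l\<close>, \<open>\<psi>\<close> with \<open>l\<^sup>T \<psi> = 1\<close> are needed only at the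
  base point \<open>t\<^sub>0\<close>. By the Fredholm alternative there is \<open>\<eta>\<close> such that, for
  \<open>w(t) = \<psi> + (t - t\<^sub>0) \<eta>\<close>, each quotient \<open>q\<^sub>i(t) = (A(t) w(t))\<^sub>i / w(t)\<^sub>i\<close> has
  value \<open>\<rho>\<close> and derivative \<open>l\<^sup>T A'(t\<^sub>0) \<psi>\<close> at \<open>t\<^sub>0\<close>. Up to a common sign \<open>w(t)\<close> is positive
  near \<open>t\<^sub>0\<close>, so the Collatz-Wielandt bounds \<open>min\<^sub>i q\<^sub>i(t) \<le> \<rho>(A(t)) \<le> max\<^sub>i q\<^sub>i(t)\<close>
  squeeze the spectral radius, and no regularity of the eigenvectors in \<open>t\<close> is required.
\<close>

section \<open>Matrices as functions of indices, and the spectral radius\<close>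

text \<open>Only arguments below \<open>n\<close> matter. With plain functions a transpose is an
  exchange of arguments, a curve of matrices is one more argument, and powers are iterates under
  \<open>^^\<close>. The type stays general because eigenvectors in the spectrum are complex, while
  Perron vectors are real.\<close>

definition mat_app :: "nat \<Rightarrow> (nat \<Rightarrow> nat \<Rightarrow> 'a) \<Rightarrow> (nat \<Rightarrow> 'a) \<Rightarrow> nat \<Rightarrow> 'a::comm_semiring_0" where
  "mat_app n a x i = (\<Sum>j<n. a i j * x j)"

abbreviation pf_ev :: "nat \<Rightarrow> (nat \<Rightarrow> nat \<Rightarrow> real) \<Rightarrow> real" where
  "pf_ev n a \<equiv> pf_eigenvalue (Matrix.mat n n (\<lambda>(i, j). a i j))"

lemma mult_mat_vec_vec:
  "Matrix.mat n n (\<lambda>(i, j). a i j) *\<^sub>v Matrix.vec n x = Matrix.vec n (mat_app n a x)"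
  by (intro eq_vecI) (auto simp: mat_app_def scalar_prod_def lessThan_atLeast0)

lemma vec_eq_smult_iff:
  "dim_vec v = n \<Longrightarrow> Matrix.vec n f = k \<cdot>\<^sub>v v \<longleftrightarrow> (\<forall>i<n. f i = k * vec_index v i)"
  unfolding Matrix.vec_eq_iff
  by (simp only: dim_vec index_smult_vec) (metis index_smult_vec(1) index_vec)

text \<open>Eigenvector facts pass to index functions through this equivalence: over the complex
  numbers for the spectrum, over the reals for the two given eigenvectors.\<close>

lemma eigenvector_mat_iff:
  "eigenvector (Matrix.mat n n (\<lambda>(i, j). a i j)) v k \<longleftrightarrow>
     dim_vec v = n \<and> (\<exists>i<n. vec_index v i \<noteq> 0) \<and>
     (\<forall>i<n. mat_app n a (vec_index v) i = k * vec_index v i)"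
proof (cases "dim_vec v = n")
  case True
  have v: "Matrix.vec n (vec_index v) = v"
    using True by (intro eq_vecI) simp_all
  have "Matrix.mat n n (\<lambda>(i, j). a i j) *\<^sub>v v = Matrix.vec n (mat_app n a (vec_index v))"
    using mult_mat_vec_vec[of n a "vec_index v"] unfolding v .
  moreover have "v \<noteq> 0\<^sub>v n \<longleftrightarrow> (\<exists>i<n. vec_index v i \<noteq> 0)"
    unfolding Matrix.vec_eq_iff using True by simp
  moreover have "v \<in> carrier_vec n"
    using True by (rule carrier_vecI)
  ultimately show ?thesis
    unfolding eigenvector_def dim_row_mat using vec_eq_smult_iff[OF True, of "mat_app n a (vec_index v)" k] True
    by argo
next
  case False
  then show ?thesis
    by (auto simp: eigenvector_def)
qed

lemma map_mat_of_real:
  "map_mat complex_of_real (Matrix.mat n n (\<lambda>(i, j). a i j)) =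
     Matrix.mat n n (\<lambda>(i, j). complex_of_real (a i j))"
  by (intro eq_matI) auto

text \<open>The spectrum is finite and nonempty, so the maximal modulus is attained, possibly at a
  non-real \<open>z\<close> with a complex eigenvector. That the spectral radius is itself an
  eigenvalue is not derived here; later lemmas receive a real eigenvector for it as an
  assumption.\<close>

lemma pf_ev_attained:
  assumes "n > 0"
  obtains z x where "pf_ev n a = cmod z" "\<exists>i<n. x i \<noteq> 0"
    "\<And>i. i < n \<Longrightarrow> mat_app n (\<lambda>i j. complex_of_real (a i j)) x i = z * x i"
proof -
  let ?B = "Matrix.mat n n (\<lambda>(i, j). complex_of_real (a i j))"
  have "spectral_radius ?B \<in> norm ` spectrum ?B"
    by (rule spectral_radius_mem_max(1)[OF _ assms]) auto
  then obtain z v where "spectral_radius ?B = cmod z" "eigenvector ?B v z"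
    by (auto simp: spectrum_def eigenvalue_def)
  then show thesis
    using that[of z "vec_index v"]
    by (auto simp: pf_eigenvalue_def map_mat_of_real eigenvector_mat_iff)
qed

lemma cmod_eigenvalue_le_pf_ev:
  assumes "n > 0" "\<exists>i<n. x i \<noteq> 0"
    "\<And>i. i < n \<Longrightarrow> mat_app n (\<lambda>i j. complex_of_real (a i j)) x i = z * x i"
  shows "cmod z \<le> pf_ev n a"
proof -
  let ?B = "Matrix.mat n n (\<lambda>(i, j). complex_of_real (a i j))"
  have "mat_app n (\<lambda>i j. complex_of_real (a i j)) (vec_index (Matrix.vec n x)) i =
      mat_app n (\<lambda>i j. complex_of_real (a i j)) x i" for i
    by (simp add: mat_app_def)
  then have "eigenvector ?B (Matrix.vec n x) z"
    using assms by (auto simp: eigenvector_mat_iff)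
  then have "cmod z \<in> norm ` spectrum ?B"
    unfolding spectrum_def eigenvalue_def by blast
  then have "cmod z \<le> spectral_radius ?B"
    by (intro spectral_radius_mem_max(2)[OF _ assms(1)]) auto
  then show ?thesis
    by (simp add: pf_eigenvalue_def map_mat_of_real)
qed

lemma pf_ev_nonneg:
  assumes "n > 0"
  shows "pf_ev n a \<ge> 0"
  using pf_ev_attained[OF assms, of a] by (metis norm_ge_zero)

section \<open>Collatz-Wielandt bounds\<close>

text \<open>Take an eigenvector \<open>x\<close> for an eigenvalue of maximal modulus and an index
  \<open>k\<close> where \<open>cmod (x k) / w k\<close> is largest. In row \<open>k\<close> of the
  eigenvalue equation, the triangle inequality and the bound on \<open>mat_app n a w\<close> give
  \<open>cmod z * cmod (x k) \<le> c * cmod (x k)\<close>, and \<open>x k\<close> is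
  nonzero.\<close>

lemma collatz_wielandt_upper:
  assumes n: "n > 0" and a: "\<And>i j. i < n \<Longrightarrow> j < n \<Longrightarrow> a i j \<ge> 0"
    and w: "\<And>i. i < n \<Longrightarrow> w i > 0"
    and le: "\<And>i. i < n \<Longrightarrow> mat_app n a w i \<le> c * w i"
  shows "pf_ev n a \<le> c"
proof -
  obtain z x where z: "pf_ev n a = cmod z" and x: "\<exists>i<n. x i \<noteq> 0"
    and ev: "\<And>i. i < n \<Longrightarrow> mat_app n (\<lambda>i j. complex_of_real (a i j)) x i = z * x i"
    using pf_ev_attained[OF n] by blast
  obtain k where k: "k < n" "\<And>i. i < n \<Longrightarrow> cmod (x i) / w i \<le> cmod (x k) / w k"
    using n ex_is_arg_min_if_finite[of "{..<n}" "\<lambda>i. - (cmod (x i) / w i)"]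
    by (auto simp: is_arg_min_linorder)
  define m where "m = cmod (x k) / w k"
  have xk: "cmod (x k) = m * w k"
    using w[OF k(1)] by (simp add: m_def)
  have xle: "cmod (x i) \<le> m * w i" if "i < n" for i
    using k(2)[OF that] w[OF that] by (simp add: m_def field_simps)
  obtain i where "i < n" "x i \<noteq> 0"
    using x by blast
  then have "0 < cmod (x i) / w i"
    using w by simp
  then have m: "m > 0"
    using k(2)[OF \<open>i < n\<close>] unfolding m_def by linarith
  have "cmod z * cmod (x k) = cmod (\<Sum>j<n. complex_of_real (a k j) * x j)"
    using ev[OF k(1)] by (simp add: mat_app_def norm_mult)
  also have "\<dots> \<le> (\<Sum>j<n. a k j * (m * w j))"
    using a[OF k(1)] xle by (intro sum_norm_le) (auto simp: norm_mult intro!: mult_left_mono)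
  also have "\<dots> = m * mat_app n a w k"
    by (simp add: mat_app_def sum_distrib_left mult_ac)
  also have "\<dots> \<le> m * (c * w k)"
    using le[OF k(1)] m by simp
  also have "\<dots> = c * cmod (x k)"
    by (simp add: xk)
  finally show ?thesis
    using z xk m w[OF k(1)] by simp
qed

lemma mat_app_mono:
  fixes a :: "nat \<Rightarrow> nat \<Rightarrow> real"
  assumes "\<And>j. j < n \<Longrightarrow> a i j \<ge> 0" "\<And>j. j < n \<Longrightarrow> x j \<le> y j"
  shows "mat_app n a x i \<le> mat_app n a y i"
  unfolding mat_app_def using assms by (intro sum_mono mult_left_mono) auto

lemma mat_app_scale: "mat_app n a (\<lambda>j. c * x j) i = c * mat_app n a x i"
  by (simp add: mat_app_def sum_distrib_left mult_ac)

text \<open>Growth of iterates is measured on real functions, whereas the bound on powers is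
  available for complex matrices; this identifies the two. The induction applies the matrix to
  \<open>w\<close> first, hence the arbitrary \<open>w\<close>.\<close>

lemma pow_mat_mult_vec:
  fixes a :: "nat \<Rightarrow> nat \<Rightarrow> real"
  shows "Matrix.mat n n (\<lambda>(i, j). complex_of_real (a i j)) ^\<^sub>m m *\<^sub>v
      Matrix.vec n (\<lambda>i. complex_of_real (w i)) =
    Matrix.vec n (\<lambda>i. complex_of_real ((mat_app n a ^^ m) w i))"
proof (induction m arbitrary: w)
  case 0
  have "1\<^sub>m n *\<^sub>v Matrix.vec n (\<lambda>i. complex_of_real (w i)) = Matrix.vec n (\<lambda>i. complex_of_real (w i))"
    by (rule one_mult_mat_vec) auto
  then show ?case
    by simp
next
  case (Suc m)
  let ?B = "Matrix.mat n n (\<lambda>(i, j). complex_of_real (a i j))"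
  let ?w = "Matrix.vec n (\<lambda>i. complex_of_real (w i))"
  have "?B ^\<^sub>m Suc m *\<^sub>v ?w = ?B ^\<^sub>m m *\<^sub>v (?B *\<^sub>v ?w)"
    by (simp, intro assoc_mult_mat_vec[of _ n n _ n]) auto
  also have "?B *\<^sub>v ?w = Matrix.vec n (\<lambda>i. complex_of_real (mat_app n a w i))"
    by (simp add: mult_mat_vec_vec) (auto intro!: eq_vecI simp: mat_app_def)
  finally show ?case
    by (simp add: Suc.IH funpow_Suc_right del: funpow.simps)
qed

text \<open>If \<open>\<rho>(a) < d < c\<close>, the powers of \<open>a / d\<close> are bounded although they expand \<open>w\<close> by \<open>c / d > 1\<close>.\<close>

lemma collatz_wielandt_lower:
  assumes n: "n > 0" and a: "\<And>i j. i < n \<Longrightarrow> j < n \<Longrightarrow> a i j \<ge> 0"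
    and w: "\<And>i. i < n \<Longrightarrow> w i \<ge> 0" and k: "k < n" "w k > 0"
    and ge: "\<And>i. i < n \<Longrightarrow> c * w i \<le> mat_app n a w i"
  shows "c \<le> pf_ev n a"
proof (rule ccontr)
  assume "\<not> c \<le> pf_ev n a"
  then obtain d where d: "pf_ev n a < d" "d < c"
    using dense[of "pf_ev n a" c] by auto
  have d0: "d > 0"
    using d pf_ev_nonneg[OF n, of a] by simp
  \<comment> \<open>Scaling by a \<open>d\<close> strictly between the two values leaves room on
    both sides: the spectral radius of \<open>b\<close> is below 1, and the growth factor
    \<open>c / d\<close> is above 1.\<close>
  define b where "b = (\<lambda>i j. a i j / d)"
  let ?B = "Matrix.mat n n (\<lambda>(i, j). complex_of_real (b i j))"
  have b_app: "mat_app n b x i = mat_app n a x i / d" for x i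
    by (simp add: mat_app_def b_def sum_divide_distrib)
  obtain z x where z: "pf_ev n b = cmod z" and x: "\<exists>i<n. x i \<noteq> 0"
    and ev: "\<And>i. i < n \<Longrightarrow> mat_app n (\<lambda>i j. complex_of_real (b i j)) x i = z * x i"
    using pf_ev_attained[OF n] by blast
  have "cmod (d * z) \<le> pf_ev n a"
  proof (rule cmod_eigenvalue_le_pf_ev[OF n x])
    fix i assume i: "i < n"
    have "mat_app n (\<lambda>i j. complex_of_real (a i j)) x i =
        d * mat_app n (\<lambda>i j. complex_of_real (b i j)) x i"
      using d0 by (simp add: mat_app_def b_def sum_distrib_left)
    then show "mat_app n (\<lambda>i j. complex_of_real (a i j)) x i = d * z * x i"
      by (simp add: ev[OF i])
  qed
  then have "d * cmod z \<le> pf_ev n a"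
    using d0 by (simp add: norm_mult)
  then have "d * cmod z < d * 1"
    using d(1) by linarith
  then have "pf_ev n b < 1"
    using d0 z by simp
  then have "spectral_radius ?B < 1"
    by (simp add: pf_eigenvalue_def map_mat_of_real)
  \<comment> \<open>The Jordan normal form bounds the entries of all powers of a matrix of spectral
    radius below 1 by one constant.\<close>
  then obtain C where C: "\<And>m. norm_bound (?B ^\<^sub>m m) C"
    using spectral_radius_jnf_norm_bound_less_1_upper_triangular[of ?B n] by auto
  define T where "T = mat_app n b"
  have T_ge: "(c / d) ^ m * w i \<le> (T ^^ m) w i" if "i < n" for m i
    using that
  proof (induction m arbitrary: i)
    case (Suc m)
    have "(c / d) ^ Suc m * w i = (c / d) ^ m * (c * w i / d)"
      by simp
    also have "\<dots> \<le> (c / d) ^ m * T w i"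
      using ge[OF Suc.prems] d d0 by (intro mult_left_mono) (auto simp: T_def b_app divide_right_mono)
    also have "\<dots> = T (\<lambda>j. (c / d) ^ m * w j) i"
      by (simp add: T_def mat_app_scale)
    also have "\<dots> \<le> T ((T ^^ m) w) i"
      unfolding T_def using Suc a d0 by (intro mat_app_mono) (auto simp: b_def T_def)
    finally show ?case
      by simp
  qed simp
  have T_le: "(T ^^ m) w k \<le> (\<Sum>j<n. C * w j)" for m
  proof -
    have dim: "dim_row (?B ^\<^sub>m m) = n" "dim_col (?B ^\<^sub>m m) = n"
      using pow_carrier_mat[of ?B n m] by auto
    have "complex_of_real ((T ^^ m) w k) = vec_index (?B ^\<^sub>m m *\<^sub>v Matrix.vec n (\<lambda>i. complex_of_real (w i))) k"
      unfolding T_def by (subst pow_mat_mult_vec) (simp add: k)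
    also have "\<dots> = (\<Sum>j<n. (?B ^\<^sub>m m) $$ (k, j) * complex_of_real (w j))"
      using k dim by (simp add: scalar_prod_def lessThan_atLeast0)
    finally have eq: "complex_of_real ((T ^^ m) w k) = \<dots>" .
    have "cmod (complex_of_real ((T ^^ m) w k)) \<le> (\<Sum>j<n. C * w j)"
      unfolding eq
    proof (rule sum_norm_le)
      fix j assume "j \<in> {..<n}"
      then have "cmod ((?B ^\<^sub>m m) $$ (k, j)) \<le> C" "w j \<ge> 0"
        using C[of m] dim k w by (auto simp: norm_bound_def)
      then show "cmod ((?B ^\<^sub>m m) $$ (k, j) * complex_of_real (w j)) \<le> C * w j"
        by (simp add: norm_mult mult_right_mono)
    qed
    then show ?thesis
      by simp
  qed
  have "1 < c / d"
    using d d0 by simp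
  then obtain m where "(\<Sum>j<n. C * w j) / w k < (c / d) ^ m"
    using real_arch_pow by blast
  then have "(\<Sum>j<n. C * w j) < (c / d) ^ m * w k"
    using k by (simp add: field_simps)
  then show False
    using T_ge[OF k(1), of m] T_le[of m] by simp
qed

section \<open>Perron eigenvectors of irreducible matrices\<close>

lemma mat_app_nonneg:
  fixes a :: "nat \<Rightarrow> nat \<Rightarrow> real"
  assumes "\<And>j. j < n \<Longrightarrow> a i j \<ge> 0" "\<And>j. j < n \<Longrightarrow> x j \<ge> 0"
  shows "mat_app n a x i \<ge> 0"
  unfolding mat_app_def using assms by (intro sum_nonneg mult_nonneg_nonneg) auto

lemma mat_app_pos:
  fixes a :: "nat \<Rightarrow> nat \<Rightarrow> real"
  assumes "\<And>j. j < n \<Longrightarrow> a i j \<ge> 0" "\<And>j. j < n \<Longrightarrow> x j \<ge> 0" "k < n" "a i k > 0" "x k > 0"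
  shows "mat_app n a x i > 0"
  unfolding mat_app_def
  by (rule sum_pos2[of _ k]) (use assms in auto)

lemma mat_app_add: "mat_app n a (\<lambda>j. x j + y j) i = mat_app n a x i + mat_app n a y i"
  by (simp add: mat_app_def distrib_left sum.distrib)

lemma mat_app_diff:
  fixes a :: "nat \<Rightarrow> nat \<Rightarrow> real"
  shows "mat_app n a (\<lambda>j. x j - y j) i = mat_app n a x i - mat_app n a y i"
  by (simp add: mat_app_def right_diff_distrib sum_subtractf)

lemma sum_mat_app_swap:
  "(\<Sum>i<n. l i * mat_app n a x i) = (\<Sum>j<n. mat_app n (\<lambda>i j. a j i) l j * x j)"
  unfolding mat_app_def sum_distrib_left sum_distrib_right
  by (subst sum.swap) (simp add: mult_ac)

text \<open>The summand \<open>I\<close> in \<open>T = I + a\<close> keeps a positive entry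
  positive, which removes any issue of periodicity; the summand \<open>a\<close> carries positivity
  from \<open>j\<close> to \<open>i\<close> whenever \<open>a i j > 0\<close>. Following a path from
  \<open>i\<close> to \<open>k\<close> backwards makes entry \<open>i\<close> eventually positive,
  and finitely many such statements share one exponent.\<close>

lemma irreducible_iterate_pos:
  fixes n :: nat and a :: "nat \<Rightarrow> nat \<Rightarrow> real"
  defines "T \<equiv> \<lambda>x i. x i + mat_app n a x i"
  assumes a: "\<And>i j. i < n \<Longrightarrow> j < n \<Longrightarrow> a i j \<ge> 0" and irr: "irreducible_on {..<n} a"
    and u: "\<And>i. i < n \<Longrightarrow> u i \<ge> 0" and k: "k < n" "u k > 0"
  obtains m where "\<And>i. i < n \<Longrightarrow> (T ^^ m) u i > 0"
proof -
  let ?E = "{(i, j). i \<in> {..<n} \<and> j \<in> {..<n} \<and> a i j > 0}"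
  have nn: "(T ^^ m) u i \<ge> 0" if "i < n" for m i
    using that
  proof (induction m arbitrary: i)
    case (Suc m)
    then show ?case
      using mat_app_nonneg[of n a i "(T ^^ m) u"] a by (simp add: T_def)
  qed (use u in simp)
  have uk: "(T ^^ m) u k > 0" for m
  proof (induction m)
    case (Suc m)
    then show ?case
      using mat_app_nonneg[of n a k "(T ^^ m) u"] nn a k by (simp add: T_def add_pos_nonneg)
  qed (use k in simp)
  have step: "\<forall>\<^sub>F m in sequentially. (T ^^ m) u i > 0"
    if ij: "(i, j) \<in> ?E" and ev: "\<forall>\<^sub>F m in sequentially. (T ^^ m) u j > 0" for i j
  proof -
    have "\<forall>\<^sub>F m in sequentially. (T ^^ Suc m) u i > 0"
      using ev
    proof eventually_elim
      case (elim m)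
      have "mat_app n a ((T ^^ m) u) i > 0"
        using ij elim nn a by (intro mat_app_pos[of n a i _ j]) auto
      then show ?case
        using nn[of i m] ij by (simp add: T_def)
    qed
    then show ?thesis
      by (subst (asm) eventually_sequentially_Suc)
  qed
  have "\<forall>\<^sub>F m in sequentially. (T ^^ m) u i > 0" if "i < n" for i
  proof -
    have "(i, k) \<in> ?E\<^sup>+"
      using irr that k by (auto simp: irreducible_on_def)
    then show ?thesis
    proof (induction rule: converse_trancl_induct)
      case (base i)
      then show ?case
        using step[of i k] uk by simp
    next
      case (step i j)
      then show ?case
        using \<open>\<And>i j. (i, j) \<in> ?E \<Longrightarrow> _ \<Longrightarrow> _\<close> by blast
    qed
  qed
  then have "\<forall>\<^sub>F m in sequentially. \<forall>i\<in>{..<n}. (T ^^ m) u i > 0"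
    by (intro eventually_ball_finite) auto
  then show thesis
    using that by (auto simp: eventually_sequentially)
qed

text \<open>If \<open>a i j > 0\<close> and \<open>x j > 0\<close>, then \<open>r * x i > 0\<close>,
  so \<open>x i\<close> is nonzero whatever the sign of \<open>r\<close>. Positivity thus spreads
  backwards along paths to \<open>k\<close>.\<close>

lemma irreducible_eigenvector_pos:
  fixes a :: "nat \<Rightarrow> nat \<Rightarrow> real"
  assumes a: "\<And>i j. i < n \<Longrightarrow> j < n \<Longrightarrow> a i j \<ge> 0" and irr: "irreducible_on {..<n} a"
    and x: "\<And>i. i < n \<Longrightarrow> x i \<ge> 0" and k: "k < n" "x k > 0"
    and ev: "\<And>i. i < n \<Longrightarrow> mat_app n a x i = r * x i"
    and i: "i < n"
  shows "x i > 0"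
proof -
  let ?E = "{(i, j). i \<in> {..<n} \<and> j \<in> {..<n} \<and> a i j > 0}"
  have step: "x i > 0" if "(i, j) \<in> ?E" "x j > 0" for i j
  proof -
    have "r * x i > 0"
      using mat_app_pos[of n a i x j] that a x ev[of i] by auto
    then have "x i \<noteq> 0"
      by auto
    then show ?thesis
      using x[of i] that by auto
  qed
  have "(i, k) \<in> ?E\<^sup>+"
    using irr i k by (auto simp: irreducible_on_def)
  then show ?thesis
    by (induction rule: converse_trancl_induct) (use k step in blast)+
qed

text \<open>
  A nonzero defect \<open>z = a \<bar>x\<bar> - \<rho> \<bar>x\<bar> \<ge> 0\<close> becomes positive under a power of \<open>I + a\<close>;
  the image of \<open>\<bar>x\<bar>\<close> under that power then violates the lower Collatz-Wielandt bound.
\<close>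

lemma perron_eigenvector_abs:
  fixes a :: "nat \<Rightarrow> nat \<Rightarrow> real"
  assumes a: "\<And>i j. i < n \<Longrightarrow> j < n \<Longrightarrow> a i j \<ge> 0" and irr: "irreducible_on {..<n} a"
    and ev: "\<And>i. i < n \<Longrightarrow> mat_app n a x i = pf_ev n a * x i"
    and k: "k < n" "x k \<noteq> 0"
    and i: "i < n"
  shows "mat_app n a (\<lambda>i. \<bar>x i\<bar>) i = pf_ev n a * \<bar>x i\<bar>"
proof (rule ccontr)
  assume ne: "mat_app n a (\<lambda>i. \<bar>x i\<bar>) i \<noteq> pf_ev n a * \<bar>x i\<bar>"
  have n: "n > 0"
    using k by simp
  define r where "r = pf_ev n a"
  have r: "r \<ge> 0"
    using pf_ev_nonneg[OF n] by (simp add: r_def)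
  define y where "y = (\<lambda>i. \<bar>x i\<bar>)"
  define z where "z = (\<lambda>i. mat_app n a y i - r * y i)"
  \<comment> \<open>The triangle inequality bounds the absolute value of each entry of
    \<open>a x\<close> by that of \<open>a y\<close>.\<close>
  have z: "z j \<ge> 0" if "j < n" for j
  proof -
    have "r * y j = \<bar>mat_app n a x j\<bar>"
      using ev[OF that] r by (simp add: y_def r_def abs_mult)
    also have "\<dots> \<le> mat_app n a y j"
      unfolding mat_app_def using a that
      by (intro order_trans[OF sum_abs] sum_mono) (auto simp: abs_mult y_def)
    finally show ?thesis
      by (simp add: z_def)
  qed
  have "z i > 0"
    using z[OF i] ne by (simp add: z_def y_def r_def)
  define T where "T = (\<lambda>x i. x i + mat_app n a x i)"
  obtain m where m: "\<And>j. j < n \<Longrightarrow> (T ^^ m) z j > 0"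
    using irreducible_iterate_pos[of n a z i, OF a irr z i \<open>z i > 0\<close>] unfolding T_def by blast
  have nn: "(T ^^ l) y j \<ge> 0" if "j < n" for l j
    using that
  proof (induction l arbitrary: j)
    case (Suc l)
    then show ?case
      using mat_app_nonneg[of n a j "(T ^^ l) y"] a by (simp add: T_def)
  qed (simp add: y_def)
  have yk: "(T ^^ l) y k > 0" for l
  proof (induction l)
    case (Suc l)
    then show ?case
      using mat_app_nonneg[of n a k "(T ^^ l) y"] nn a k by (simp add: T_def add_pos_nonneg)
  qed (use k in \<open>simp add: y_def\<close>)
  \<comment> \<open>\<open>T\<close> is \<open>I + a\<close> and commutes with \<open>a\<close>, so
    iterating the defect gives the defect of the iterate.\<close>
  have comm: "(T ^^ l) z = (\<lambda>i. mat_app n a ((T ^^ l) y) i - r * (T ^^ l) y i)" for l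
  proof (induction l)
    case (Suc l)
    show ?case
      by (rule ext) (simp add: Suc, simp add: T_def mat_app_add mat_app_diff mat_app_scale algebra_simps)
  qed (simp add: z_def)
  define Y where "Y = (\<Sum>j<n. (T ^^ m) y j)"
  have Yk: "(T ^^ m) y j \<le> Y" if "j < n" for j
    unfolding Y_def using nn that by (intro member_le_sum) auto
  have Y: "Y > 0"
    using Yk[OF k(1)] yk[of m] by linarith
  \<comment> \<open>\<open>Y\<close> bounds every entry of \<open>(T ^^ m) y\<close>, so
    \<open>e\<close> times that vector stays below the least entry of \<open>(T ^^ m) z\<close>.
    This raises the lower quotient bound from \<open>r\<close> to \<open>r + e\<close>.\<close>
  define e where "e = Min ((T ^^ m) z ` {..<n}) / Y"
  have e: "e > 0"
    unfolding e_def using Y m n by (intro divide_pos_pos, subst Min_gr_iff) auto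
  have "r + e \<le> pf_ev n a"
  proof (rule collatz_wielandt_lower[of n a "(T ^^ m) y" k, OF n a nn k(1) yk])
    fix j assume j: "j < n"
    have "e * (T ^^ m) y j \<le> e * Y"
      using e Yk[OF j] by simp
    also have "\<dots> = Min ((T ^^ m) z ` {..<n})"
      using Y by (simp add: e_def)
    also have "\<dots> \<le> (T ^^ m) z j"
      using j by (intro Min_le) auto
    finally show "(r + e) * (T ^^ m) y j \<le> mat_app n a ((T ^^ m) y) j"
      by (simp add: comm algebra_simps)
  qed
  then show False
    using e by (simp add: r_def)
qed

text \<open>Subtract the largest multiple of \<open>y\<close> that leaves \<open>x - c y\<close>
  nonnegative. The difference vanishes at the minimizing index \<open>k\<close>, whereas a nonzero
  nonnegative eigenvector would be positive everywhere.\<close>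

lemma perron_eigenvector_unique:
  fixes a :: "nat \<Rightarrow> nat \<Rightarrow> real"
  assumes n: "n > 0" and a: "\<And>i j. i < n \<Longrightarrow> j < n \<Longrightarrow> a i j \<ge> 0" and irr: "irreducible_on {..<n} a"
    and y: "\<And>i. i < n \<Longrightarrow> y i > 0" "\<And>i. i < n \<Longrightarrow> mat_app n a y i = r * y i"
    and x: "\<And>i. i < n \<Longrightarrow> mat_app n a x i = r * x i"
  obtains c where "\<And>i. i < n \<Longrightarrow> x i = c * y i"
proof -
  obtain k where k: "k < n" "\<And>i. i < n \<Longrightarrow> x k / y k \<le> x i / y i"
    using n ex_is_arg_min_if_finite[of "{..<n}" "\<lambda>i. x i / y i"]
    by (auto simp: is_arg_min_linorder)
  define c where "c = x k / y k"
  define u where "u = (\<lambda>i. x i - c * y i)"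
  have u: "u i \<ge> 0" if "i < n" for i
    using k(2)[OF that] y(1)[OF that] by (simp add: u_def c_def field_simps)
  have uk: "u k = 0"
    using y(1)[OF k(1)] by (simp add: u_def c_def)
  have ev: "mat_app n a u i = r * u i" if "i < n" for i
    using x[OF that] y(2)[OF that] by (simp add: u_def mat_app_diff mat_app_scale algebra_simps)
  have "u i = 0" if "i < n" for i
    using irreducible_eigenvector_pos[of n a u i r k, OF a irr u that _ ev k(1)] u[OF that] uk
    by force
  then show thesis
    using that[of c] by (simp add: u_def)
qed

text \<open>The absolute values of \<open>x\<close> form a positive eigenvector \<open>y\<close>, so
  uniqueness gives \<open>x = c y\<close> with \<open>c\<close> nonzero. The factor \<open>c\<close>
  itself serves as \<open>s\<close>, since \<open>c * x i\<close> is
  \<open>c\<^sup>2 * y i\<close>.\<close>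

lemma perron_eigenvector_sign:
  fixes a :: "nat \<Rightarrow> nat \<Rightarrow> real"
  assumes a: "\<And>i j. i < n \<Longrightarrow> j < n \<Longrightarrow> a i j \<ge> 0" and irr: "irreducible_on {..<n} a"
    and ev: "\<And>i. i < n \<Longrightarrow> mat_app n a x i = pf_ev n a * x i"
    and k: "k < n" "x k \<noteq> 0"
  obtains s where "\<And>i. i < n \<Longrightarrow> s * x i > 0"
proof -
  define y where "y = (\<lambda>i. \<bar>x i\<bar>)"
  have yev: "mat_app n a y i = pf_ev n a * y i" if "i < n" for i
    using perron_eigenvector_abs[of n a x k, OF a irr ev k that] by (simp add: y_def)
  have y: "y i > 0" if "i < n" for i
    using irreducible_eigenvector_pos[of n a y k "pf_ev n a" i, OF a irr _ k(1) _ yev that] k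
    by (simp add: y_def)
  obtain c where c: "\<And>i. i < n \<Longrightarrow> x i = c * y i"
    using perron_eigenvector_unique[of n a y "pf_ev n a" x, OF _ a irr y yev ev] k by auto
  then have "c \<noteq> 0"
    using k by auto
  show thesis
  proof (rule that)
    fix i assume i: "i < n"
    have "c * x i = c\<^sup>2 * y i"
      by (simp add: c[OF i] power2_eq_square)
    then show "c * x i > 0"
      using y[OF i] \<open>c \<noteq> 0\<close> by simp
  qed
qed

text \<open>Makes the logarithm differentiable. Irreducibility uses the transitive, not the
  reflexive, closure: even \<open>k\<close> must reach itself by a nonempty path, so row
  \<open>k\<close> has a positive entry, also when \<open>n = 1\<close>.\<close>

lemma pf_ev_pos:
  fixes a :: "nat \<Rightarrow> nat \<Rightarrow> real"
  assumes a: "\<And>i j. i < n \<Longrightarrow> j < n \<Longrightarrow> a i j \<ge> 0" and irr: "irreducible_on {..<n} a"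
    and ev: "\<And>i. i < n \<Longrightarrow> mat_app n a x i = pf_ev n a * x i"
    and k: "k < n" "x k \<noteq> 0"
  shows "pf_ev n a > 0"
proof -
  obtain s where s: "\<And>i. i < n \<Longrightarrow> s * x i > 0"
    using perron_eigenvector_sign[of n a x k, OF a irr ev k] by blast
  have "(k, k) \<in> {(i, j). i \<in> {..<n} \<and> j \<in> {..<n} \<and> a i j > 0}\<^sup>+"
    using irr k by (auto simp: irreducible_on_def)
  then obtain j where "j < n" "a k j > 0"
    by (cases rule: converse_tranclE) auto
  then have "mat_app n a (\<lambda>i. s * x i) k > 0"
    using a k s by (intro mat_app_pos[of _ _ _ _ j]) (auto intro: less_imp_le)
  then have "pf_ev n a * (s * x k) > 0"
    using ev[OF k(1)] by (simp add: mat_app_scale mult_ac)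
  then show ?thesis
    using s[OF k(1)] by (simp add: zero_less_mult_iff)
qed

section \<open>The Fredholm alternative at the Perron eigenvalue\<close>

text \<open>A trivial kernel forces a nonzero determinant, hence an inverse matrix, which produces
  the solution.\<close>

lemma mat_app_surj:
  fixes b :: "nat \<Rightarrow> nat \<Rightarrow> 'a::field"
  assumes inj: "\<And>x i. (\<And>i. i < n \<Longrightarrow> mat_app n b x i = 0) \<Longrightarrow> i < n \<Longrightarrow> x i = 0"
  obtains x where "\<And>i. i < n \<Longrightarrow> mat_app n b x i = c i"
proof -
  let ?B = "Matrix.mat n n (\<lambda>(i, j). b i j)"
  have "Determinant.det ?B \<noteq> 0"
  proof
    assume "Determinant.det ?B = 0"
    then obtain v where v: "v \<in> carrier_vec n" "v \<noteq> 0\<^sub>v n" "?B *\<^sub>v v = 0\<^sub>v n"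
      using det_0_iff_vec_prod_zero_field[of ?B n] by auto
    have vv: "Matrix.vec n (vec_index v) = v"
      using v(1) by (intro eq_vecI) simp_all
    have 0: "Matrix.vec n (mat_app n b (vec_index v)) = 0\<^sub>v n"
      using mult_mat_vec_vec[of n b "vec_index v"] v(3) unfolding vv by simp
    have "mat_app n b (vec_index v) i = 0" if "i < n" for i
      using arg_cong[OF 0, of "\<lambda>v. vec_index v i"] that by simp
    then have "vec_index v i = 0" if "i < n" for i
      using inj that by blast
    then have "v = 0\<^sub>v n"
      using v(1) by (intro eq_vecI) simp_all
    with v(2) show False
      by simp
  qed
  then have "?B \<in> Units (ring_mat TYPE('a) n ())"
    by (intro det_non_zero_imp_unit) simp_all
  then obtain C where C: "C \<in> carrier_mat n n" "?B * C = 1\<^sub>m n"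
    by (auto simp: Units_def ring_mat_def)
  define v where "v = C *\<^sub>v Matrix.vec n c"
  have v: "v \<in> carrier_vec n"
    using C by (simp add: v_def carrier_vecI)
  have "?B *\<^sub>v v = (?B * C) *\<^sub>v Matrix.vec n c"
    unfolding v_def using C(1) by (intro assoc_mult_mat_vec[symmetric, of _ n n _ n]) simp_all
  also have "\<dots> = Matrix.vec n c"
    unfolding C(2) by (rule one_mult_mat_vec) simp
  finally have Bv: "?B *\<^sub>v v = Matrix.vec n c" .
  have vv: "Matrix.vec n (vec_index v) = v"
    using v by (intro eq_vecI) simp_all
  have eq: "Matrix.vec n (mat_app n b (vec_index v)) = Matrix.vec n c"
    using mult_mat_vec_vec[of n b "vec_index v"] Bv unfolding vv by simp
  show thesis
  proof (rule that)
    fix i assume "i < n"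
    then show "mat_app n b (vec_index v) i = c i"
      using arg_cong[OF eq, of "\<lambda>v. vec_index v i"] by simp
  qed
qed

text \<open>Adding the rank-one matrix \<open>\<psi> l\<^sup>T\<close> makes \<open>r I - a\<close> invertible.\<close>

lemma perron_fredholm:
  fixes a :: "nat \<Rightarrow> nat \<Rightarrow> real"
  assumes unique: "\<And>x. (\<And>i. i < n \<Longrightarrow> mat_app n a x i = r * x i) \<Longrightarrow> \<exists>c. \<forall>i<n. x i = c * \<psi> i"
    and right: "\<And>i. i < n \<Longrightarrow> mat_app n a \<psi> i = r * \<psi> i"
    and left: "\<And>j. j < n \<Longrightarrow> mat_app n (\<lambda>i j. a j i) l j = r * l j"
    and norm: "(\<Sum>i<n. l i * \<psi> i) = 1"
    and orth: "(\<Sum>i<n. l i * b i) = 0"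
  obtains x where "\<And>i. i < n \<Longrightarrow> r * x i - mat_app n a x i = b i"
proof -
  define B where "B = (\<lambda>i j. (if i = j then r else 0) - a i j + \<psi> i * l j)"
  have B: "mat_app n B x i = r * x i - mat_app n a x i + \<psi> i * (\<Sum>j<n. l j * x j)" if "i < n" for x i
    using that
    by (simp add: mat_app_def B_def algebra_simps sum.distrib sum_subtractf sum_distrib_left
        if_distrib[of "\<lambda>c. _ * c"] cong: if_cong)
  \<comment> \<open>\<open>l\<close> annihilates \<open>r I - a\<close> from the left and pairs with
    \<open>\<psi>\<close> to 1, so \<open>l\<close> is a left eigenvector of \<open>B\<close> with
    eigenvalue 1. Hence a solution of \<open>B x = b\<close> satisfies \<open>l x = l b = 0\<close>,
    and the rank-one term drops out.\<close>
  have lB: "(\<Sum>i<n. l i * mat_app n B x i) = (\<Sum>j<n. l j * x j)" for x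
  proof -
    define p where "p = (\<Sum>j<n. l j * x j)"
    have "(\<Sum>i<n. l i * mat_app n B x i) =
        (\<Sum>i<n. r * (l i * x i) - l i * mat_app n a x i + (l i * \<psi> i) * p)"
      by (intro sum.cong) (auto simp: B p_def[symmetric] algebra_simps)
    also have "\<dots> = r * (\<Sum>i<n. l i * x i) - (\<Sum>i<n. l i * mat_app n a x i) + (\<Sum>i<n. l i * \<psi> i) * p"
      by (simp add: sum.distrib sum_subtractf sum_distrib_left sum_distrib_right)
    also have "(\<Sum>i<n. l i * mat_app n a x i) = r * (\<Sum>j<n. l j * x j)"
      unfolding sum_mat_app_swap by (simp add: left sum_distrib_left mult_ac)
    finally show ?thesis
      by (simp add: norm p_def)
  qed
  \<comment> \<open>For injectivity, \<open>B x = 0\<close> gives \<open>l x = 0\<close>; then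
    \<open>x\<close> is an eigenvector of \<open>a\<close>, so a multiple of \<open>\<psi>\<close>,
    and \<open>l \<psi> = 1\<close> makes the multiple zero.\<close>
  obtain x where x: "\<And>i. i < n \<Longrightarrow> mat_app n B x i = b i"
  proof (rule mat_app_surj[of n B b])
    fix x i
    assume 0: "\<And>i. i < n \<Longrightarrow> mat_app n B x i = 0" and i: "i < n"
    have lx: "(\<Sum>j<n. l j * x j) = 0"
      using lB[of x] 0 by simp
    have "mat_app n a x j = r * x j" if "j < n" for j
      using B[OF that, of x] 0[OF that] lx by simp
    then obtain c where c: "\<And>j. j < n \<Longrightarrow> x j = c * \<psi> j"
      using unique by blast
    have "c * (\<Sum>j<n. l j * \<psi> j) = 0"
      using lx by (simp add: c sum_distrib_left mult_ac)
    then show "x i = 0"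
      using norm c[OF i] by simp
  qed auto
  have "(\<Sum>j<n. l j * x j) = 0"
    using lB[of x] x orth by simp
  then show thesis
    using that[of x] B[of _ x] x by simp
qed

section \<open>Derivative of the Perron-Frobenius eigenvalue along a curve\<close>

text \<open>The bounding indices may change with \<open>t\<close>, so the deviation of the
  difference quotient of \<open>f\<close> from \<open>D\<close> is bounded by the sum of the
  deviations over all of \<open>I\<close>, which tends to 0. To the left of \<open>t0\<close> the
  two bounds exchange roles.\<close>

lemma has_real_derivative_between:
  fixes f :: "real \<Rightarrow> real"
  assumes fin: "finite I"
    and q: "\<And>i. i \<in> I \<Longrightarrow> (q i has_real_derivative D) (at t0)" "\<And>i. i \<in> I \<Longrightarrow> q i t0 = f t0"
    and between: "\<forall>\<^sub>F t in at t0. \<exists>i\<in>I. \<exists>j\<in>I. q i t \<le> f t \<and> f t \<le> q j t"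
  shows "(f has_real_derivative D) (at t0)"
proof -
  let ?s = "\<lambda>g t. (g t - g t0) / (t - t0) - D"
  have "(?s (q i) \<longlongrightarrow> 0) (at t0)" if "i \<in> I" for i
    using q(1)[OF that] unfolding has_field_derivative_iff by (rule LIM_zero)
  then have lim: "((\<lambda>t. \<Sum>i\<in>I. \<bar>?s (q i) t\<bar>) \<longlongrightarrow> 0) (at t0)"
    by (intro tendsto_null_sum tendsto_rabs_zero)
  have "\<forall>\<^sub>F t in at t0. norm (?s f t) \<le> (\<Sum>i\<in>I. \<bar>?s (q i) t\<bar>)"
    using between eventually_neq_at_within[of t0 t0 UNIV]
  proof eventually_elim
    case (elim t)
    then obtain i j where ij: "i \<in> I" "j \<in> I" "q i t \<le> f t" "f t \<le> q j t"
      by blast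
    have le: "\<bar>?s (q i) t\<bar> \<le> (\<Sum>i\<in>I. \<bar>?s (q i) t\<bar>)" if "i \<in> I" for i
      by (rule member_le_sum[OF that]) (use fin in auto)
    have "\<bar>?s f t\<bar> \<le> max \<bar>?s (q i) t\<bar> \<bar>?s (q j) t\<bar>"
    proof (cases "t > t0")
      case True
      then have "?s (q i) t \<le> ?s f t" "?s f t \<le> ?s (q j) t"
        using ij q(2) by (auto intro!: divide_right_mono)
      then show ?thesis by linarith
    next
      case False
      then have "?s (q j) t \<le> ?s f t" "?s f t \<le> ?s (q i) t"
        using ij q(2) elim by (auto intro!: divide_right_mono_neg)
      then show ?thesis by linarith
    qed
    then show ?case
      using le[OF ij(1)] le[OF ij(2)] by simp
  qed
  then have "(?s f \<longlongrightarrow> 0) (at t0)"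
    by (rule Lim_null_comparison[OF _ lim])
  then show ?thesis
    unfolding has_field_derivative_iff by (rule LIM_zero_cancel)
qed

text \<open>Nonnegativity is assumed for every \<open>t\<close>, because the quotient bounds are
  applied to \<open>A t\<close>; irreducibility is assumed at \<open>t0\<close>, where it gives the
  sign and the uniqueness of \<open>\<psi>\<close>.\<close>

lemma pf_ev_has_derivative:
  fixes A :: "real \<Rightarrow> nat \<Rightarrow> nat \<Rightarrow> real"
  assumes nonneg: "\<And>t i j. i < n \<Longrightarrow> j < n \<Longrightarrow> A t i j \<ge> 0"
    and irr: "irreducible_on {..<n} (A t0)"
    and deriv: "\<And>i j. i < n \<Longrightarrow> j < n \<Longrightarrow> ((\<lambda>t. A t i j) has_real_derivative A' i j) (at t0)"
    and right: "\<And>i. i < n \<Longrightarrow> mat_app n (A t0) \<psi> i = pf_ev n (A t0) * \<psi> i"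
    and left: "\<And>j. j < n \<Longrightarrow> mat_app n (\<lambda>i j. A t0 j i) l j = pf_ev n (A t0) * l j"
    and norm: "(\<Sum>i<n. l i * \<psi> i) = 1"
  shows "((\<lambda>t. pf_ev n (A t)) has_real_derivative (\<Sum>i<n. l i * mat_app n A' \<psi> i)) (at t0)"
proof -
  define r where "r = pf_ev n (A t0)"
  define D where "D = (\<Sum>i<n. l i * mat_app n A' \<psi> i)"
  obtain k where k: "k < n" "\<psi> k \<noteq> 0"
  proof -
    have "\<exists>k<n. \<psi> k \<noteq> 0"
      using norm by (rule contrapos_pp) simp
    then show ?thesis
      using that by blast
  qed
  then have n: "n > 0"
    by simp
  obtain s where s: "\<And>i. i < n \<Longrightarrow> s * \<psi> i > 0"
    using perron_eigenvector_sign[of n "A t0" \<psi> k, OF nonneg irr right k] by blast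
  have unique: "\<exists>c. \<forall>i<n. x i = c * \<psi> i" if x: "\<And>i. i < n \<Longrightarrow> mat_app n (A t0) x i = r * x i" for x
  proof -
    have "mat_app n (A t0) (\<lambda>i. s * \<psi> i) i = r * (s * \<psi> i)" if "i < n" for i
      using right[OF that] by (simp add: mat_app_scale r_def)
    then obtain c where "\<And>i. i < n \<Longrightarrow> x i = c * (s * \<psi> i)"
      using perron_eigenvector_unique[of n "A t0" "\<lambda>i. s * \<psi> i" r x, OF n nonneg irr s _ x] by blast
    then show ?thesis
      by (intro exI[of _ "c * s"]) simp
  qed
  \<comment> \<open>The solvability condition for \<open>\<eta>\<close>: the right-hand side must be
    orthogonal to \<open>l\<close>, and this determines \<open>D\<close>.\<close>
  have "(\<Sum>i<n. l i * (mat_app n A' \<psi> i - D * \<psi> i)) =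
      (\<Sum>i<n. l i * mat_app n A' \<psi> i) - D * (\<Sum>i<n. l i * \<psi> i)"
    by (simp add: right_diff_distrib sum_subtractf sum_distrib_left mult_ac)
  also have "\<dots> = 0"
    by (simp add: norm D_def)
  finally obtain \<eta> where \<eta>: "\<And>i. i < n \<Longrightarrow> r * \<eta> i - mat_app n (A t0) \<eta> i = mat_app n A' \<psi> i - D * \<psi> i"
    using perron_fredholm[of n "A t0" r \<psi> l "\<lambda>i. mat_app n A' \<psi> i - D * \<psi> i"] unique right left norm
    unfolding r_def by blast
  define w where "w = (\<lambda>t i. \<psi> i + (t - t0) * \<eta> i)"
  define q where "q = (\<lambda>i t. mat_app n (A t) (w t) i / w t i)"
  have w0: "w t0 = \<psi>"
    by (simp add: w_def)
  have dw: "((\<lambda>t. w t i) has_real_derivative \<eta> i) (at t0)" for i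
    unfolding w_def by (auto intro!: derivative_eq_intros)
  have \<psi>: "\<psi> i \<noteq> 0" if "i < n" for i
    using s[OF that] by auto
  have dq: "(q i has_real_derivative D) (at t0)" if i: "i < n" for i
  proof -
    have "((\<lambda>t. mat_app n (A t) (w t) i) has_real_derivative
        (\<Sum>j<n. A' i j * \<psi> j + \<eta> j * A t0 i j)) (at t0)"
      unfolding mat_app_def w0[symmetric]
      by (intro DERIV_sum DERIV_mult deriv dw i) auto
    moreover have "(\<Sum>j<n. A' i j * \<psi> j + \<eta> j * A t0 i j) = mat_app n A' \<psi> i + mat_app n (A t0) \<eta> i"
      by (simp add: mat_app_def sum.distrib mult_ac)
    moreover have "mat_app n A' \<psi> i + mat_app n (A t0) \<eta> i = D * \<psi> i + r * \<eta> i"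
      using \<eta>[OF i] by simp
    ultimately have "((\<lambda>t. mat_app n (A t) (w t) i) has_real_derivative D * \<psi> i + r * \<eta> i) (at t0)"
      by simp
    \<comment> \<open>At \<open>t0\<close> the numerator of \<open>q i\<close> is
      \<open>r * \<psi> i\<close>, so the two \<open>\<eta>\<close> terms of the quotient rule
      cancel and \<open>D\<close> is left for every \<open>i\<close>.\<close>
    from DERIV_divide[OF this dw[of i]]
    have "(q i has_real_derivative
        ((D * \<psi> i + r * \<eta> i) * \<psi> i - r * \<psi> i * \<eta> i) / (\<psi> i * \<psi> i)) (at t0)"
      using \<psi>[OF i] unfolding q_def w0 right[OF i, folded r_def] by blast
    then show ?thesis
      using \<psi>[OF i] by (simp add: algebra_simps)
  qed
  show ?thesis
    unfolding D_def[symmetric]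
  proof (rule has_real_derivative_between[where I = "{..<n}" and q = q])
    have "\<forall>\<^sub>F t in at t0. s * w t i > 0" if "i < n" for i
    proof -
      have "((\<lambda>t. s * w t i) \<longlongrightarrow> s * w t0 i) (at t0)"
        unfolding w_def by (intro tendsto_intros)
      then show ?thesis
        using s[OF that] by (intro order_tendstoD(1)) (auto simp: w0)
    qed
    then have "\<forall>\<^sub>F t in at t0. \<forall>i\<in>{..<n}. s * w t i > 0"
      by (intro eventually_ball_finite) auto
    then show "\<forall>\<^sub>F t in at t0. \<exists>i\<in>{..<n}. \<exists>j\<in>{..<n}. q i t \<le> pf_ev n (A t) \<and> pf_ev n (A t) \<le> q j t"
    proof eventually_elim
      case (elim t)
      \<comment> \<open>The sign \<open>s\<close> cancels in the quotient, so the
        \<open>q i t\<close> are also the quotients of the positive vector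
        \<open>s w(t)\<close>.\<close>
      have qw: "mat_app n (A t) (\<lambda>i. s * w t i) i = q i t * (s * w t i)" if "i < n" for i
      proof -
        have "s * w t i > 0"
          using elim that by simp
        then have "w t i \<noteq> 0"
          by auto
        then show ?thesis
          by (simp add: q_def mat_app_scale)
      qed
      obtain i where i: "i < n" "\<And>j. j < n \<Longrightarrow> q i t \<le> q j t"
        using n ex_is_arg_min_if_finite[of "{..<n}" "\<lambda>i. q i t"]
        by (auto simp: is_arg_min_linorder)
      obtain j where j: "j < n" "\<And>i. i < n \<Longrightarrow> q i t \<le> q j t"
        using n ex_is_arg_min_if_finite[of "{..<n}" "\<lambda>i. - q i t"]
        by (auto simp: is_arg_min_linorder)
      have "q i t \<le> pf_ev n (A t)"
        by (rule collatz_wielandt_lower[OF n nonneg _ i(1), where w = "\<lambda>i. s * w t i"])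
          (use elim i qw in \<open>auto simp: less_imp_le intro!: mult_right_mono\<close>)
      moreover have "pf_ev n (A t) \<le> q j t"
        by (rule collatz_wielandt_upper[OF n nonneg, where w = "\<lambda>i. s * w t i"])
          (use elim j qw in \<open>auto simp: less_imp_le intro!: mult_right_mono\<close>)
      ultimately show ?case
        using i(1) j(1) by blast
    qed
  next
    fix i assume "i \<in> {..<n}"
    then show "q i t0 = pf_ev n (A t0)"
      using right[of i] \<psi>[of i] by (simp add: q_def w0)
  qed (use dq in auto)
qed

section \<open>Application to the tilted matrices\<close>

text \<open>Irreducibility concerns only which entries are positive, so paths between states pull
  back along the inverse of \<open>f\<close> to paths between indices.\<close>

lemma irreducible_on_bij_betw:
  assumes irr: "irreducible_on A p" and f: "bij_betw f I A"
    and pos: "\<And>i j. i \<in> I \<Longrightarrow> j \<in> I \<Longrightarrow> p (f i) (f j) > 0 \<Longrightarrow> b i j > 0"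
  shows "irreducible_on I b"
  unfolding irreducible_on_def
proof (intro ballI)
  let ?E = "{(u, v). u \<in> A \<and> v \<in> A \<and> p u v > 0}"
  let ?F = "{(i, j). i \<in> I \<and> j \<in> I \<and> b i j > 0}"
  let ?g = "inv_into I f"
  have g: "?g u \<in> I" "f (?g u) = u" if "u \<in> A" for u
    using f that by (auto simp: bij_betw_def inv_into_into f_inv_into_f)
  have step: "(?g u, ?g v) \<in> ?F" if "(u, v) \<in> ?E" for u v
    using that g pos[of "?g u" "?g v"] by auto
  fix i j assume ij: "i \<in> I" "j \<in> I"
  then have "(f i, f j) \<in> ?E\<^sup>+"
    using irr f by (auto simp: irreducible_on_def dest: bij_betwE)
  then have "(?g (f i), ?g (f j)) \<in> ?F\<^sup>+"
  proof (induction rule: trancl_induct)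
    case (base v)
    then show ?case
      using step by (intro r_into_trancl) blast
  next
    case (step u v)
    then show ?case
      using \<open>\<And>u v. (u, v) \<in> ?E \<Longrightarrow> _\<close> by (blast intro: trancl_into_trancl)
  qed
  then show "(i, j) \<in> ?F\<^sup>+"
    using ij f by (simp add: bij_betw_def inv_into_f_f)
qed

text \<open>The trace is the sum of \<open>Q $ i $ k * R $ k $ i\<close>, hence affine in
  \<open>t\<close>; entry \<open>(a, b)\<close> meets entry \<open>(b, a)\<close>.\<close>

lemma trace_entry_has_derivative:
  fixes Q R :: "real ^ ('n::finite) ^ 'n"
  shows "((\<lambda>t. trace ((\<chi> i j. if i = a \<and> j = b then t else Q $ i $ j) ** R))
           has_real_derivative R $ b $ a) (at x)"
proof -
  have "((\<lambda>t. \<Sum>i\<in>UNIV. \<Sum>k\<in>UNIV. (if i = a \<and> k = b then t else Q $ i $ k) * R $ k $ i)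
      has_real_derivative
      (\<Sum>i\<in>UNIV. \<Sum>k\<in>UNIV. if i = a then if k = b then R $ k $ i else 0 else 0)) (at x)"
    by (intro DERIV_sum) (auto intro!: derivative_eq_intros)
  also have "(\<Sum>i\<in>UNIV. \<Sum>k\<in>UNIV. if i = a then if k = b then R $ k $ i else 0 else 0) = R $ b $ a"
    by (subst sum.swap) simp
  finally show ?thesis
    by (simp add: trace_def matrix_matrix_mult_def)
qed

lemma transpose_mat_of_fun:
  "transpose_mat (Matrix.mat n n (\<lambda>(i, j). a i j)) = Matrix.mat n n (\<lambda>(i, j). a j i)"
  by (intro eq_matI) simp_all

theorem lemma7:
  fixes \<Omega> :: "'w measure"
    and \<X> \<S> :: "real set"
    and P\<^sub>S :: "real pmf"
    and \<pi>\<^sub>0 \<pi>\<^sub>1 :: "real \<Rightarrow> real \<Rightarrow> real"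
    and S :: "nat \<Rightarrow> 'w \<Rightarrow> real"
    and X :: "('r::finite) option \<Rightarrow> nat \<Rightarrow> 'w \<Rightarrow> real"
    and P :: "real ^ 'r option ^ 'r option \<Rightarrow> real ^ 'r option ^ 'r option \<Rightarrow> real"
    and M :: nat
    and Qbar :: "nat \<Rightarrow> real ^ 'r option ^ 'r option"
    and Qt :: "real ^ 'r option ^ 'r option"
    and l \<psi> :: "real Matrix.vec"
  assumes "prob_space \<Omega>"
    and "finite \<X>" and "finite \<S>" and "\<S> \<subseteq> {0<..}"
    and "set_pmf P\<^sub>S \<subseteq> \<S>"
    and "\<And>n. S n \<in> measurable \<Omega> (count_space \<S>)"
    and "\<And>n. distr \<Omega> (count_space UNIV) (S n) = measure_pmf P\<^sub>S"
    and "prob_space.indep_vars \<Omega> (\<lambda>_. borel) S UNIV"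
    and "irreducible_markov_chain \<Omega> \<X> \<pi>\<^sub>0 (X None)"
    and "\<And>a. irreducible_markov_chain \<Omega> \<X> \<pi>\<^sub>1 (X (Some a))"
    and "\<And>a b. distr \<Omega> (\<Pi>\<^sub>M n\<in>UNIV. borel) (\<lambda>\<omega> n. X (Some a) n \<omega>)
             = distr \<Omega> (\<Pi>\<^sub>M n\<in>UNIV. borel) (\<lambda>\<omega> n. X (Some b) n \<omega>)"
    and "prob_space.indep_vars \<Omega> (\<lambda>_. \<Pi>\<^sub>M n\<in>UNIV. borel)
           (\<lambda>c \<omega> n. case c of None \<Rightarrow> S n \<omega> | Some a \<Rightarrow> X a n \<omega>)
           (UNIV :: 'r option option set)"
    and "irreducible_markov_chain \<Omega> (rank_one_states \<S> \<X>) P (Q_process S X)"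
    and "M = card (rank_one_states \<S> \<X> :: (real ^ 'r option ^ 'r option) set) - 1"
    and "bij_betw Qbar {0..M} (rank_one_states \<S> \<X>)"
    and "eigenvector (transpose_mat (tilted_matrix (M + 1) Qbar P Qt)) l
           (pf_eigenvalue (tilted_matrix (M + 1) Qbar P Qt))"
    and "eigenvector (tilted_matrix (M + 1) Qbar P Qt) \<psi>
           (pf_eigenvalue (tilted_matrix (M + 1) Qbar P Qt))"
    and "scalar_prod l \<psi> = 1"
  shows "has_matrix_of_partials
           (\<lambda>Q. ln (pf_eigenvalue (tilted_matrix (M + 1) Qbar P Q)))
           ((1 / pf_eigenvalue (tilted_matrix (M + 1) Qbar P Qt)) *\<^sub>R
              (\<Sum>i=0..M. vec_index l i *\<^sub>R
                 (\<Sum>j=0..M. (vec_index \<psi> j * P (Qbar i) (Qbar j) * exp (trace (Qt ** Qbar j)))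
                    *\<^sub>R Qbar j)))
           Qt"
proof -
  define n where "n = M + 1"
  define Qx where "Qx = (\<lambda>a b t. \<chi> i j. if i = a \<and> j = b then t else Qt $ i $ j)"
  define A where "A = (\<lambda>Q i j. exp (trace (Q ** Qbar j)) * P (Qbar i) (Qbar j))"
  define r where "r = pf_ev n (A Qt)"
  have tilted: "tilted_matrix (M + 1) Qbar P Q = Matrix.mat n n (\<lambda>(i, j). A Q i j)" for Q
    by (simp add: tilted_matrix_def A_def n_def)
  have I: "{0..M} = {..<n}"
    by (auto simp: n_def)
  have bij: "bij_betw Qbar {..<n} (rank_one_states \<S> \<X>)"
    using assms(15) by (simp only: I)
  have Qbar: "Qbar i \<in> rank_one_states \<S> \<X>" if "i < n" for i
    using bij that by (auto dest: bij_betwE)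
  \<comment> \<open>\<open>\<partial> tr(Q R) / \<partial> Q\<^sub>a\<^sub>b\<close> is \<open>R\<^sub>b\<^sub>a\<close>, so the formula relies on the symmetry of the states.\<close>
  have sym: "Qbar i $ b $ a = Qbar i $ a $ b" if "i < n" for i a b
    using Qbar[OF that] by (auto simp: rank_one_states_def)
  have P: "P (Qbar i) (Qbar j) \<ge> 0" if "i < n" "j < n" for i j
    using assms(13) Qbar that by (simp add: irreducible_markov_chain_def markov_chain_def)
  have A: "A Q i j \<ge> 0" if "i < n" "j < n" for Q i j
    using P[OF that] by (simp add: A_def)
  \<comment> \<open>The exponential factor is positive, so every tilt keeps the positive entries of
    \<open>P\<close>.\<close>
  have irr: "irreducible_on {..<n} (A Q)" for Q
    by (rule irreducible_on_bij_betw[OF _ bij, of P])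
      (use assms(13) in \<open>auto simp: irreducible_markov_chain_def A_def\<close>)
  have right: "dim_vec \<psi> = n" "\<exists>i<n. vec_index \<psi> i \<noteq> 0"
    "\<And>i. i < n \<Longrightarrow> mat_app n (A Qt) (vec_index \<psi>) i = r * vec_index \<psi> i"
    using assms(17) unfolding tilted eigenvector_mat_iff r_def by blast+
  have left: "\<And>j. j < n \<Longrightarrow> mat_app n (\<lambda>i j. A Qt j i) (vec_index l) j = r * vec_index l j"
    using assms(16) unfolding tilted transpose_mat_of_fun eigenvector_mat_iff r_def by blast
  have norm: "(\<Sum>i<n. vec_index l i * vec_index \<psi> i) = 1"
    using assms(18) by (simp add: scalar_prod_def right(1) lessThan_atLeast0)
  have r: "r > 0"
    using right(2) pf_ev_pos[OF A irr right(3)[unfolded r_def]] unfolding r_def by blast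
  show ?thesis
    unfolding has_matrix_of_partials_def
  proof (intro allI)
    fix a b
    let ?t0 = "Qt $ a $ b"
    have Qt: "Qx a b ?t0 = Qt"
      by (auto simp: Qx_def Finite_Cartesian_Product.vec_eq_iff)
    \<comment> \<open>Moving entry \<open>(a, b)\<close> of the tilt differentiates the exponent of
      \<open>A Qt i j\<close>, which yields the factor \<open>Qbar j $ a $ b\<close> by the chain
      rule.\<close>
    define A' where "A' = (\<lambda>i j. A Qt i j * Qbar j $ a $ b)"
    have "((\<lambda>t. A (Qx a b t) i j) has_real_derivative A' i j) (at ?t0)" if "j < n" for i j
    proof -
      have "((\<lambda>t. trace (Qx a b t ** Qbar j)) has_real_derivative Qbar j $ a $ b) (at ?t0)"
        using trace_entry_has_derivative[of a b Qt "Qbar j"] unfolding Qx_def sym[OF that, of a b] .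
      from DERIV_cmult_right[OF DERIV_fun_exp[OF this], of "P (Qbar i) (Qbar j)"] show ?thesis
        by (simp add: A_def A'_def Qt mult_ac)
    qed
    then have "((\<lambda>t. pf_ev n (A (Qx a b t))) has_real_derivative
        (\<Sum>i<n. vec_index l i * mat_app n A' (vec_index \<psi>) i)) (at ?t0)"
      using pf_ev_has_derivative[of n "\<lambda>t. A (Qx a b t)" ?t0 A' "vec_index \<psi>" "vec_index l"]
        A irr right(3) left norm
      unfolding Qt r_def by blast
    from DERIV_chain2[OF DERIV_ln_divide this]
    have "((\<lambda>t. ln (pf_ev n (A (Qx a b t)))) has_real_derivative
        1 / r * (\<Sum>i<n. vec_index l i * mat_app n A' (vec_index \<psi>) i)) (at ?t0)"
      using r unfolding Qt r_def by blast
    moreover have "1 / r * (\<Sum>i<n. vec_index l i * mat_app n A' (vec_index \<psi>) i) =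
        ((1 / r) *\<^sub>R (\<Sum>i<n. vec_index l i *\<^sub>R
          (\<Sum>j<n. (vec_index \<psi> j * P (Qbar i) (Qbar j) * exp (trace (Qt ** Qbar j))) *\<^sub>R Qbar j)))
        $ a $ b"
      by (simp add: mat_app_def A'_def A_def mult_ac)
    ultimately show "((\<lambda>t. ln (pf_eigenvalue (tilted_matrix (M + 1) Qbar P
          (\<chi> i j. if i = a \<and> j = b then t else Qt $ i $ j))))
        has_real_derivative
        ((1 / pf_eigenvalue (tilted_matrix (M + 1) Qbar P Qt)) *\<^sub>R
          (\<Sum>i=0..M. vec_index l i *\<^sub>R
            (\<Sum>j=0..M. (vec_index \<psi> j * P (Qbar i) (Qbar j) * exp (trace (Qt ** Qbar j))) *\<^sub>R Qbar j)))
        $ a $ b) (at ?t0)"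
      unfolding tilted I r_def Qx_def by (simp only:)
  qed
qed

end
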